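(* Let $r\ge 1$ and $d\ge 2$ be integers. Let $\boldsymbol{\phi}$ be a two-direction multiscaling function of multiplicity $r$ and dilation factor $d$ with real recursion coefficients $P^{+}_k,P^{-}_k\in\mathbb{R}^{r\times r}$, and let $\boldsymbol{\psi}^{(s)}$, $s=1,\dots,d-1$, be two-direction multiwavelets associated with $\boldsymbol{\phi}$ with real recursion coefficients $Q^{(s)+}_k,Q^{(s)-}_k\in\mathbb{R}^{r\times r}$. Assume that $\boldsymbol{\phi}$ is orthogonal, has compact support, is continuous (which implies approximation order at least $1$), and satisfies Condition E. Let $\boldsymbol{\Phi}(x)=[\boldsymbol{\phi}(x),\boldsymbol{\phi}(-x)]^T$ and $\boldsymbol{\Psi}^{(s)}(x)=[\boldsymbol{\psi}^{(s)}(x),\boldsymbol{\psi}^{(s)}(-x)]^T$. Then the continuous moments $\boldsymbol{m}^{\pm}_j$ of $\boldsymbol{\Phi}$ and $\boldsymbol{n}^{(s)\pm}_j$ of $\boldsymbol{\Psi}^{(s)}$ can be computed recursively as follows. For $j=0$: $$\boldsymbol{m}^{\pm}_0=M^{\pm}_0\boldsymbol{m}^{\pm}_0,\qquad\text{with normalization}\qquad (\boldsymbol{m}^{\pm}_0)^*\boldsymbol{m}^{\pm}_0=1.$$ For $j=1,2,3,\dots$: the matrix $d^jI_{2r}-M^{\pm}_0$ is invertible and $$\boldsymbol{m}^{\pm}_j=\left(d^jI_{2r}-M^{\pm}_0\right)^{-1}\sum_{\ell=0}^{j-1}\binom{j}{\ell}M^{\pm}_{j-\ell}\boldsymbol{m}^{\pm}_\ell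 .$$ For $j=0,1,2,\dots$ and $s=1,\dots,d-1$: $$\boldsymbol{n}^{(s)\pm}_j=d^{-j}\sum_{\ell=0}^{j}\binom{j}{\ell}N^{(s)\pm}_{j-\ell}\boldsymbol{m}^{\pm}_\ell .$$ Here $I_{2r}$ is the $2r\times 2r$ identity matrix. Once $\boldsymbol{m}^{\pm}_0$ has been chosen, all other continuous moments are uniquely defined and are computed recursively from the last two formulas. Finally, the $j$th continuous moments $\boldsymbol{m}_j$ of $\boldsymbol{\phi}$ and $\boldsymbol{n}^{(s)}_j$ of $\boldsymbol{\psi}^{(s)}$ are the upper halves (first $r$ entries) of $\boldsymbol{m}^{\pm}_j$ and $\boldsymbol{n}^{(s)\pm}_j$, respectively, for $s=1,\dots,d-1$.
   Context: A two-direction multiscaling function of multiplicity $r$ and dilation factor $d$ is a vector $\boldsymbol{\phi}=[\phi_1,\dots,\phi_r]^T$ of real- or complex-valued functions on $\mathbb{R}$ satisfying $$\boldsymbol{\phi}(x)=\sqrt d\sum_{k\in\mathbb{Z}}\left[P^+_k\boldsymbol{\phi}(dx-k)+P^-_k\boldsymbol{\phi}(k-dx)\right]$$ and generating a multiresolution approximation of $L^2(\mathbb{R})$ (in the usual sense, the level-$j$ space being spanned by all $\boldsymbol{\phi}(d^jx-k)$ and $\boldsymbol{\phi}(k-d^jx)$, $k\in\mathbb{Z}$). Two-direction multiwavelets $\boldsymbol{\psi}^{(s)}$, $s=1,\dots,d-1$, associated with $\boldsymbol{\phi}$ are vectors of $r$ functions with $$\boldsymbol{\psi}^{(s)}(x)=\sqrt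 d\sum_{k\in\mathbb{Z}}\left[Q^{(s)+}_k\boldsymbol{\phi}(dx-k)+Q^{(s)-}_k\boldsymbol{\phi}(k-dx)\right].$$ All recursion coefficients are real $r\times r$ matrices, and only finitely many of them are nonzero. Inner product: $\langle \boldsymbol{f},\boldsymbol{g}\rangle=\int \boldsymbol{f}(x)\boldsymbol{g}(x)^*\,dx$, an $r\times r$ matrix; $*$ is the complex conjugate transpose. $\boldsymbol{\phi}$ is orthogonal if $\langle\boldsymbol{\phi}(x-j),\boldsymbol{\phi}(x-k)\rangle=\delta_{jk}I_r$ and $\langle\boldsymbol{\phi}(x-j),\boldsymbol{\phi}(k-x)\rangle=0$ for all $j,k\in\mathbb{Z}$. Condition E: a matrix satisfies Condition E if it has a simple eigenvalue $1$ and all other eigenvalues are smaller than $1$ in absolute value. $\boldsymbol{\phi}$ satisfies Condition E if the $2r\times2r$ matrix $\frac1{\sqrt d}\sum_{k}\begin{bmatrix}P^+_k&P^-_k\\P^-_k&P^+_k\end{bmatrix}$ does. Approximation order: $\boldsymbol{\phi}$ provides approximation order $p$ if $\|f-P_nf\|=O(d^{-np})$ whenever $f$ has $p$ continuous derivatives, where $P_nf$ is the level-$n$ expansion $\sum_k[\langle f,\boldsymbol{\phi}^+_{nk}\rangle\boldsymbol{\phi}^+_{nk}+\langle f,\boldsymbol{\phi}^-_{nk}\rangle\boldsymbol{\phi}^-_{nk}]$ with $\boldsymbol{\phi}^{\pm}_{nk}(x)=d^{n/2}\boldsymbol{\phi}(\pm(d^nx-k))$. It is known to be equivalent to accuracy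 $p$: every polynomial of degree at most $p-1$ is locally a linear combination of the functions $\boldsymbol{\phi}(x-k)$ and $\boldsymbol{\phi}(k-x)$, $k\in\mathbb{Z}$. In $\boldsymbol{\Phi}$ and $\boldsymbol{\Psi}^{(s)}$ the two vectors are stacked into a column of length $2r$. Discrete moments ($j=0,1,2,\dots$, with $k^0=1$ for all $k$): $$M^{\pm}_j=\frac1{\sqrt d}\sum_{k\in\mathbb{Z}}k^j\begin{bmatrix}P^+_k&P^-_k\\P^-_{-k}&P^+_{-k}\end{bmatrix},\qquad N^{(s)\pm}_j=\frac1{\sqrt d}\sum_{k\in\mathbb{Z}}k^j\begin{bmatrix}Q^{(s)+}_k&Q^{(s)-}_k\\Q^{(s)-}_{-k}&Q^{(s)+}_{-k}\end{bmatrix}.$$ Continuous moments: $\boldsymbol{m}_j=\int x^j\boldsymbol{\phi}(x)\,dx$, $\boldsymbol{n}^{(s)}_j=\int x^j\boldsymbol{\psi}^{(s)}(x)\,dx$ (vectors of size $r$), and $\boldsymbol{m}^{\pm}_j=\int x^j\boldsymbol{\Phi}(x)\,dx$, $\boldsymbol{n}^{(s)\pm}_j=\int x^j\boldsymbol{\Psi}^{(s)}(x)\,dx$ (vectors of size $2r$), all integrals over $\mathbb{R}$. *)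

theory Defs
  imports "HOL-Analysis.Analysis" "HOL-Computational_Algebra.Polynomial"
begin

text \<open>
  The multiplicity \<open>r\<close> is the cardinality of the index type \<open>'r\<close>; vectors and matrices of size
  \<open>2 r\<close> are indexed by the sum type \<open>'r + 'r\<close>, with \<open>Inl\<close> for the upper (left) and \<open>Inr\<close> for the
  lower (right) half. Function values are complex, which includes the real-valued case. The
  recursion coefficients are complex matrices that the predicates below require to have real
  entries.
\<close>

definition real_matrix :: "complex^'m^'n \<Rightarrow> bool" where
  "real_matrix A \<longleftrightarrow> (\<forall>i j. A $ i $ j \<in> \<real>)"

definition stack_vec :: "'a^'m \<Rightarrow> 'a^'n \<Rightarrow> 'a^('m::finite + 'n::finite)" where
  "stack_vec u v = (\<chi> i. case i of Inl a \<Rightarrow> u $ a | Inr b \<Rightarrow> v $ b)"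

definition upper_half :: "'a^('m::finite + 'n::finite) \<Rightarrow> 'a^'m" where
  "upper_half v = (\<chi> a. v $ Inl a)"

definition block_matrix ::
  "'a^'r^'r \<Rightarrow> 'a^'r^'r \<Rightarrow> 'a^'r^'r \<Rightarrow> 'a^'r^'r \<Rightarrow> 'a^('r::finite + 'r)^('r + 'r)" where
  "block_matrix A B C D = (\<chi> i. case i of
      Inl a \<Rightarrow> stack_vec (A $ a) (B $ a)
    | Inr a \<Rightarrow> stack_vec (C $ a) (D $ a))"

text \<open>\<open>u\<^sup>* v\<close> for column vectors.\<close>

definition conj_dot :: "complex^'n \<Rightarrow> complex^'n \<Rightarrow> complex" where
  "conj_dot u v = (\<Sum>i\<in>UNIV. cnj (u $ i) * v $ i)"


subsection \<open>Two-direction refinement equations\<close>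

text \<open>The sums over \<open>\<int>\<close> are finite sums under the finite-support assumptions made below.\<close>

definition two_direction_sum ::
  "nat \<Rightarrow> (int \<Rightarrow> complex^'r^'r) \<Rightarrow> (int \<Rightarrow> complex^'r^'r) \<Rightarrow> (real \<Rightarrow> complex^'r)
    \<Rightarrow> real \<Rightarrow> complex^'r" where
  "two_direction_sum d Cp Cm \<phi> x =
     sqrt (real d) *\<^sub>R
       (\<Sum>\<^sub>\<infinity>k\<in>UNIV. Cp k *v \<phi> (real d * x - of_int k) + Cm k *v \<phi> (of_int k - real d * x))"

definition real_finite_coeffs :: "(int \<Rightarrow> complex^'r^'r) \<Rightarrow> bool" where
  "real_finite_coeffs C \<longleftrightarrow> finite {k. C k \<noteq> 0} \<and> (\<forall>k. real_matrix (C k))"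


subsection \<open>Multiresolution approximations of \<open>L\<^sup>2(\<real>)\<close>\<close>

text \<open>Elements of \<open>L\<^sup>2(\<real>)\<close> are represented by Borel measurable functions; two functions that agree
  almost everywhere represent the same element.\<close>

definition L2 :: "(real \<Rightarrow> complex) set" where
  "L2 = {f. f \<in> borel_measurable lborel \<and> integrable lborel (\<lambda>x. (cmod (f x))\<^sup>2)}"

definition L2_norm :: "(real \<Rightarrow> complex) \<Rightarrow> real" where
  "L2_norm f = sqrt (LINT x|lborel. (cmod (f x))\<^sup>2)"

text \<open>Linear combinations, over a set \<open>K\<close> of integers, of the component functions of
  \<open>\<phi>(d\<^sup>n x - k)\<close> and \<open>\<phi>(k - d\<^sup>n x)\<close>.\<close>

definition level_combination ::
  "nat \<Rightarrow> (real \<Rightarrow> complex^'r) \<Rightarrow> int \<Rightarrow> int set \<Rightarrow> (int \<Rightarrow> complex^'r) \<Rightarrow> (int \<Rightarrow> complex^'r)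
    \<Rightarrow> real \<Rightarrow> complex" where
  "level_combination d \<phi> n K a b x =
     (\<Sum>k\<in>K. \<Sum>i\<in>UNIV. a k $ i * \<phi> (real d powi n * x - of_int k) $ i
                    + b k $ i * \<phi> (of_int k - real d powi n * x) $ i)"

text \<open>The closed linear span in \<open>L\<^sup>2(\<real>)\<close>.\<close>

definition level_space :: "nat \<Rightarrow> (real \<Rightarrow> complex^'r) \<Rightarrow> int \<Rightarrow> (real \<Rightarrow> complex) set" where
  "level_space d \<phi> n =
     {f \<in> L2. \<forall>e>0. \<exists>K a b. finite K \<and> L2_norm (\<lambda>x. f x - level_combination d \<phi> n K a b x) < e}"

text \<open>The usual axioms; some of them are automatic for spaces that are spanned as above. The last
  one says that the functions \<open>\<phi>(x - k)\<close>, \<open>\<phi>(k - x)\<close> form a Riesz basis of the level-0 space.\<close>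

definition generates_MRA :: "nat \<Rightarrow> (real \<Rightarrow> complex^'r) \<Rightarrow> bool" where
  "generates_MRA d \<phi> \<longleftrightarrow>
     (\<forall>i. (\<lambda>x. \<phi> x $ i) \<in> L2) \<and>
     (\<forall>n. level_space d \<phi> n \<subseteq> level_space d \<phi> (n + 1)) \<and>
     (\<forall>n f. f \<in> level_space d \<phi> n \<longleftrightarrow> (\<lambda>x. f (real d * x)) \<in> level_space d \<phi> (n + 1)) \<and>
     (\<forall>n f k. f \<in> level_space d \<phi> n \<longleftrightarrow>
        (\<lambda>x. f (x - real d powi (- n) * of_int k)) \<in> level_space d \<phi> n) \<and>
     (\<forall>f\<in>L2. \<forall>e>0. \<exists>n. \<exists>g\<in>level_space d \<phi> n. L2_norm (\<lambda>x. f x - g x) < e) \<and>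
     (\<forall>f. (\<forall>n. f \<in> level_space d \<phi> n) \<longrightarrow> (AE x in lborel. f x = 0)) \<and>
     (\<exists>A B. 0 < A \<and> A \<le> B \<and>
        (\<forall>K a b. finite K \<longrightarrow>
           A * (\<Sum>k\<in>K. (norm (a k))\<^sup>2 + (norm (b k))\<^sup>2)
             \<le> (L2_norm (level_combination d \<phi> 0 K a b))\<^sup>2 \<and>
           (L2_norm (level_combination d \<phi> 0 K a b))\<^sup>2
             \<le> B * (\<Sum>k\<in>K. (norm (a k))\<^sup>2 + (norm (b k))\<^sup>2)))"


subsection \<open>Multiscaling functions and multiwavelets\<close>

definition two_direction_multiscaling ::
  "nat \<Rightarrow> (int \<Rightarrow> complex^'r^'r) \<Rightarrow> (int \<Rightarrow> complex^'r^'r) \<Rightarrow> (real \<Rightarrow> complex^'r) \<Rightarrow> bool" where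
  "two_direction_multiscaling d Pp Pm \<phi> \<longleftrightarrow>
     real_finite_coeffs Pp \<and> real_finite_coeffs Pm \<and>
     (\<forall>x. \<phi> x = two_direction_sum d Pp Pm \<phi> x) \<and>
     generates_MRA d \<phi>"

definition two_direction_multiwavelets ::
  "nat \<Rightarrow> (real \<Rightarrow> complex^'r) \<Rightarrow> (nat \<Rightarrow> int \<Rightarrow> complex^'r^'r) \<Rightarrow> (nat \<Rightarrow> int \<Rightarrow> complex^'r^'r)
    \<Rightarrow> (nat \<Rightarrow> real \<Rightarrow> complex^'r) \<Rightarrow> bool" where
  "two_direction_multiwavelets d \<phi> Qp Qm \<psi> \<longleftrightarrow>
     (\<forall>s\<in>{1..d - 1}.
        real_finite_coeffs (Qp s) \<and> real_finite_coeffs (Qm s) \<and>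
        (\<forall>x. \<psi> s x = two_direction_sum d (Qp s) (Qm s) \<phi> x))"

definition matrix_inner :: "(real \<Rightarrow> complex^'r) \<Rightarrow> (real \<Rightarrow> complex^'r) \<Rightarrow> complex^'r^'r" where
  "matrix_inner f g = (\<chi> i j. LINT x|lborel. f x $ i * cnj (g x $ j))"

definition two_direction_orthogonal :: "(real \<Rightarrow> complex^'r) \<Rightarrow> bool" where
  "two_direction_orthogonal \<phi> \<longleftrightarrow>
     (\<forall>j k :: int.
        matrix_inner (\<lambda>x. \<phi> (x - of_int j)) (\<lambda>x. \<phi> (x - of_int k)) = (if j = k then mat 1 else 0) \<and>
        matrix_inner (\<lambda>x. \<phi> (x - of_int j)) (\<lambda>x. \<phi> (of_int k - x)) = 0)"

definition has_compact_support :: "(real \<Rightarrow> 'a::zero) \<Rightarrow> bool" where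
  "has_compact_support f \<longleftrightarrow> compact (closure {x. f x \<noteq> 0})"


subsection \<open>Condition E\<close>

definition charpoly :: "complex^'n^'n \<Rightarrow> complex poly" where
  "charpoly A = det (\<chi> i j. (if i = j then [:0, 1:] else 0) - [:A $ i $ j:])"

definition is_eigenvalue :: "complex^'n^'n \<Rightarrow> complex \<Rightarrow> bool" where
  "is_eigenvalue A z \<longleftrightarrow> (\<exists>v. v \<noteq> 0 \<and> A *v v = z *s v)"

text \<open>An eigenvalue is simple if its algebraic multiplicity is 1.\<close>

definition condition_E_matrix :: "complex^'n^'n \<Rightarrow> bool" where
  "condition_E_matrix A \<longleftrightarrow>
     is_eigenvalue A 1 \<and> order 1 (charpoly A) = 1 \<and>
     (\<forall>z. is_eigenvalue A z \<and> z \<noteq> 1 \<longrightarrow> cmod z < 1)"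

definition condition_E ::
  "nat \<Rightarrow> (int \<Rightarrow> complex^'r^'r) \<Rightarrow> (int \<Rightarrow> complex^'r^'r) \<Rightarrow> bool" where
  "condition_E d Pp Pm \<longleftrightarrow>
     condition_E_matrix
       ((1 / sqrt (real d)) *\<^sub>R (\<Sum>\<^sub>\<infinity>k\<in>UNIV. block_matrix (Pp k) (Pm k) (Pm k) (Pp k)))"


subsection \<open>Moments\<close>

definition discrete_moment ::
  "nat \<Rightarrow> (int \<Rightarrow> complex^'r^'r) \<Rightarrow> (int \<Rightarrow> complex^'r^'r) \<Rightarrow> nat
    \<Rightarrow> complex^('r::finite + 'r)^('r + 'r)" where
  "discrete_moment d Cp Cm j =
     (1 / sqrt (real d)) *\<^sub>R
       (\<Sum>\<^sub>\<infinity>k\<in>UNIV. (real_of_int k ^ j) *\<^sub>R block_matrix (Cp k) (Cm k) (Cm (- k)) (Cp (- k)))"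

definition continuous_moment :: "(real \<Rightarrow> complex^'n) \<Rightarrow> nat \<Rightarrow> complex^'n" where
  "continuous_moment f j = (LINT x|lborel. (x ^ j) *\<^sub>R f x)"

definition two_sided :: "(real \<Rightarrow> complex^'r) \<Rightarrow> real \<Rightarrow> complex^('r::finite + 'r)" where
  "two_sided f x = stack_vec (f x) (f (- x))"

end

theory Submission
  imports Defs
begin

text \<open>
  Stack \<open>\<phi>(x)\<close> and \<open>\<phi>(-x)\<close> into the vector \<open>\<Phi>(x)\<close> of twice the length. Then \<open>\<Phi>\<close> satisfies an
  ordinary refinement equation \<open>\<Phi>(x) = \<surd>d \<Sum>\<^sub>k B\<^sub>k \<Phi>(d x - k)\<close>, the multiwavelets satisfy the same
  kind of equation with \<open>\<Phi>\<close> on the right (\<open>two_sided_refinement\<close>), and the integer translates of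
  all components of \<open>\<Phi>\<close> are orthonormal (\<open>two_sided_orthonormal\<close>).

  The recursions come from multiplying the refinement equation by \<open>x\<^sup>j\<close>, integrating, substituting
  \<open>y = d x - k\<close> and expanding \<open>((y + k) / d)\<^sup>j\<close> binomially (\<open>continuous_moment_refinement\<close>). For
  the multiwavelets this is the claimed formula. For \<open>\<Phi>\<close> it reads
  \<open>d\<^sup>j m\<^sub>j = M\<^sub>0 m\<^sub>j + (terms in m\<^sub>0, ..., m\<^sub>j\<^sub>-\<^sub>1)\<close>. For \<open>j = 0\<close> this is the fixed point
  equation. For \<open>j \<ge> 1\<close> it can be solved for \<open>m\<^sub>j\<close>: by Condition E no eigenvalue of \<open>M\<^sub>0\<close> exceeds
  1 in modulus, so \<open>d\<^sup>j > 1\<close> is not an eigenvalue. Uniqueness follows by induction on \<open>j\<close>.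

  The normalization of \<open>m\<^sub>0\<close> is the one assertion that depends on the multiresolution
  approximation being dense in \<open>L\<^sup>2(\<real>)\<close>. Project the indicator function of \<open>[0, 1]\<close> onto the span
  of the orthonormal functions \<open>D\<^sup>1\<^sup>/\<^sup>2 \<Phi>\<^sub>i(D x - k)\<close> with \<open>D = d\<^sup>n\<close>. Apart from a bounded number
  of \<open>k\<close> near the two end points, the coefficient is \<open>D\<^sup>-\<^sup>1\<^sup>/\<^sup>2\<close> times the conjugate of \<open>\<integral>\<Phi>\<^sub>i\<close>
  when the support lies inside the interval, which happens for \<open>D - O(1)\<close> values of \<open>k\<close>, and is 0
  when it lies outside. So the squared norm of the projection is \<open>m\<^sub>0\<^sup>* m\<^sub>0 + O(1/D)\<close>. Bessel's
  inequality bounds it by the squared norm 1 of the indicator function, and density forces it to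
  converge to 1 (\<open>integral_norm_square_eq_one\<close>).
\<close>

section \<open>Reduction to an ordinary refinement equation\<close>

definition stacked_coeff ::
  "(int \<Rightarrow> complex^'r^'r) \<Rightarrow> (int \<Rightarrow> complex^'r^'r) \<Rightarrow> int \<Rightarrow> complex^('r::finite + 'r)^('r + 'r)" where
  "stacked_coeff Cp Cm k = block_matrix (Cp k) (Cm k) (Cm (- k)) (Cp (- k))"

lemma sum_UNIV_Plus:
  fixes f :: "'a::finite + 'b::finite \<Rightarrow> 'c::comm_monoid_add"
  shows "(\<Sum>i\<in>UNIV. f i) = (\<Sum>a\<in>UNIV. f (Inl a)) + (\<Sum>b\<in>UNIV. f (Inr b))"
proof -
  have "(\<Sum>i\<in>UNIV. f i) = (\<Sum>i\<in>UNIV <+> UNIV. f i)" by simp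
  also have "\<dots> = (\<Sum>a\<in>UNIV. f (Inl a)) + (\<Sum>b\<in>UNIV. f (Inr b))"
    by (subst sum.Plus) (auto simp: comp_def)
  finally show ?thesis .
qed

lemma stack_vec_nth [simp]:
  "stack_vec u v $ Inl a = u $ a" "stack_vec u v $ Inr b = v $ b"
  by (simp_all add: stack_vec_def)

lemma stack_vec_scaleR: "stack_vec (c *\<^sub>R u) (c *\<^sub>R v) = c *\<^sub>R stack_vec u v"
  by (simp add: vec_eq_iff split_sum_all)

lemma stack_vec_sum: "stack_vec (\<Sum>k\<in>K. u k) (\<Sum>k\<in>K. v k) = (\<Sum>k\<in>K. stack_vec (u k) (v k))"
  by (simp add: vec_eq_iff split_sum_all)

lemma block_matrix_mult_stack_vec:
  fixes A B C D :: "'a::comm_semiring_1^'r^'r"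
  shows "block_matrix A B C D *v stack_vec u v = stack_vec (A *v u + B *v v) (C *v u + D *v v)"
  by (simp add: vec_eq_iff split_sum_all matrix_vector_mult_def block_matrix_def sum_UNIV_Plus)

lemma block_matrix_zero [simp]: "block_matrix 0 0 0 0 = 0"
  by (simp add: vec_eq_iff split_sum_all block_matrix_def)

text \<open>
  The index set has to be closed under negation because the stacked coefficients involve both \<open>k\<close>
  and \<open>-k\<close>.
\<close>

lemma obtain_symmetric_support:
  assumes "real_finite_coeffs Cp" "real_finite_coeffs Cm"
  obtains K where "finite K" "\<And>k. k \<notin> K \<Longrightarrow> Cp k = 0 \<and> Cm k = 0" "\<And>k. - k \<in> K \<longleftrightarrow> k \<in> K"
proof
  let ?S = "{k. Cp k \<noteq> 0} \<union> {k. Cm k \<noteq> 0}"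
  show "finite (?S \<union> uminus ` ?S)"
    using assms by (simp add: real_finite_coeffs_def)
  show "Cp k = 0 \<and> Cm k = 0" if "k \<notin> ?S \<union> uminus ` ?S" for k
    using that by auto
  show "- k \<in> ?S \<union> uminus ` ?S \<longleftrightarrow> k \<in> ?S \<union> uminus ` ?S" for k
    by (force simp: image_iff)
qed

lemma infsum_eq_finite_sum:
  assumes "finite K" "\<And>k. k \<notin> K \<Longrightarrow> f k = 0"
  shows "(\<Sum>\<^sub>\<infinity>k\<in>UNIV. f k) = (\<Sum>k\<in>K. f k)"
proof -
  have "(\<Sum>\<^sub>\<infinity>k\<in>UNIV. f k) = (\<Sum>\<^sub>\<infinity>k\<in>K. f k)"
    by (rule infsum_cong_neutral) (use assms in auto)
  then show ?thesis using assms(1) by simp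
qed

lemma discrete_moment_finite_sum:
  assumes "finite K" "\<And>k. k \<notin> K \<Longrightarrow> Cp k = 0 \<and> Cm k = 0" "\<And>k. - k \<in> K \<longleftrightarrow> k \<in> K"
  shows "discrete_moment d Cp Cm j =
    (1 / sqrt (real d)) *\<^sub>R (\<Sum>k\<in>K. (real_of_int k ^ j) *\<^sub>R stacked_coeff Cp Cm k)"
  unfolding discrete_moment_def stacked_coeff_def[symmetric]
  by (subst infsum_eq_finite_sum[OF assms(1)]) (use assms in \<open>auto simp: stacked_coeff_def\<close>)

text \<open>
  The refinement equation at \<open>x\<close> gives the upper half, the one at \<open>-x\<close> with the summation index
  reflected gives the lower half. The reflection is the reason why the lower blocks of the stacked
  coefficients carry the index \<open>-k\<close>. Stacking thus turns a two-direction equation for \<open>\<phi>\<close> into a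
  one-direction equation for \<open>two_sided \<phi>\<close>.
\<close>

lemma two_sided_refinement:
  assumes K: "finite K" "\<And>k. k \<notin> K \<Longrightarrow> Cp k = 0 \<and> Cm k = 0" "\<And>k. - k \<in> K \<longleftrightarrow> k \<in> K"
    and f: "\<And>x. f x = two_direction_sum d Cp Cm \<phi> x"
  shows "two_sided f x = sqrt (real d) *\<^sub>R
    (\<Sum>k\<in>K. stacked_coeff Cp Cm k *v two_sided \<phi> (real d * x - of_int k))"
proof -
  have f': "f x = sqrt (real d) *\<^sub>R
      (\<Sum>k\<in>K. Cp k *v \<phi> (real d * x - of_int k) + Cm k *v \<phi> (of_int k - real d * x))" for x
    unfolding f two_direction_sum_def
    by (subst infsum_eq_finite_sum[OF K(1)]) (use K in auto)
  have flip: "real d * (- x) - of_int k = of_int (- k) - real d * x"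
    "of_int k - real d * (- x) = real d * x - of_int (- k)" for k
    by simp_all
  have "(\<Sum>k\<in>K. Cp k *v \<phi> (real d * (- x) - of_int k) + Cm k *v \<phi> (of_int k - real d * (- x)))
      = (\<Sum>k\<in>K. Cm (- k) *v \<phi> (real d * x - of_int k) + Cp (- k) *v \<phi> (of_int k - real d * x))"
    unfolding flip
    by (rule sum.reindex_bij_witness[where i = uminus and j = uminus])
       (simp_all add: K(3) add.commute)
  then show ?thesis
    unfolding two_sided_def stacked_coeff_def f' block_matrix_mult_stack_vec stack_vec_scaleR minus_diff_eq
    by (simp add: stack_vec_sum)
qed

section \<open>Moments of refinable functions\<close>

lemma matrix_vector_scaleR_right:
  fixes A :: "complex^'n^'m"
  shows "A *v (c *\<^sub>R x) = c *\<^sub>R (A *v x)"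
  by (simp add: vec_eq_iff matrix_vector_mult_def scaleR_sum_right)

lemma matrix_vector_scaleR_left:
  fixes A :: "complex^'n^'m"
  shows "(c *\<^sub>R A) *v x = c *\<^sub>R (A *v x)"
  by (simp add: vec_eq_iff matrix_vector_mult_def scaleR_sum_right)

lemma matrix_vector_sum_left:
  fixes A :: "'k \<Rightarrow> complex^'n^'m"
  shows "(\<Sum>k\<in>K. A k) *v x = (\<Sum>k\<in>K. A k *v x)"
  by (induction K rule: infinite_finite_induct) (simp_all add: matrix_vector_mult_add_rdistrib)

lemma matrix_vector_sum_right:
  fixes A :: "complex^'n^'m"
  shows "A *v (\<Sum>k\<in>K. x k) = (\<Sum>k\<in>K. A *v x k)"
  by (induction K rule: infinite_finite_induct) (simp_all add: matrix_vector_right_distrib)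

text \<open>
  Substituting \<open>y = d x - t\<close> turns \<open>x\<^sup>j\<close> into \<open>((y + t) / d)\<^sup>j\<close>, which the binomial theorem
  expands into powers of \<open>y\<close>; one more factor \<open>1 / d\<close> comes from \<open>dx = dy / d\<close>.
\<close>

lemma has_moment_dilated_shift:
  fixes \<Phi> :: "real \<Rightarrow> complex^'n"
  assumes int: "\<And>j. integrable lborel (\<lambda>x. (x ^ j) *\<^sub>R \<Phi> x)" and d: "d > 0"
  shows "has_bochner_integral lborel (\<lambda>x. (x ^ j) *\<^sub>R \<Phi> (d * x - t))
    ((1 / d ^ Suc j) *\<^sub>R (\<Sum>l=0..j. (real (j choose l) * t ^ (j - l)) *\<^sub>R continuous_moment \<Phi> l))"
proof -
  have expand: "(((y + t) / d) ^ j) *\<^sub>R \<Phi> y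
     = (1 / d ^ j) *\<^sub>R (\<Sum>l=0..j. (real (j choose l) * t ^ (j - l)) *\<^sub>R ((y ^ l) *\<^sub>R \<Phi> y))" for y
    by (simp add: power_divide binomial_ring atMost_atLeast0 scaleR_sum_left[symmetric] mult_ac)
  have *: "has_bochner_integral lborel (\<lambda>y. (((y + t) / d) ^ j) *\<^sub>R \<Phi> y)
    ((1 / d ^ j) *\<^sub>R (\<Sum>l=0..j. (real (j choose l) * t ^ (j - l)) *\<^sub>R continuous_moment \<Phi> l))"
    unfolding expand continuous_moment_def
    by (intro has_bochner_integral_scaleR_right has_bochner_integral_sum has_bochner_integral_integrable int)
  have "has_bochner_integral lborel (\<lambda>x. (((- t + d * x + t) / d) ^ j) *\<^sub>R \<Phi> (- t + d * x))
     ((1 / d ^ j) *\<^sub>R (\<Sum>l=0..j. (real (j choose l) * t ^ (j - l)) *\<^sub>R continuous_moment \<Phi> l) /\<^sub>R \<bar>d\<bar>)"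
    using * d by (subst (asm) lborel_has_bochner_integral_real_affine_iff[of d _ _ "- t"]) auto
  then show ?thesis
    using d by (simp add: field_simps)
qed

text \<open>
  Integrating the refinement equation against \<open>x\<^sup>j\<close> term by term and collecting, for each \<open>l\<close>, the
  powers \<open>k\<^sup>j\<^sup>-\<^sup>l\<close> that accompany the \<open>l\<close>th moment of \<open>\<Phi>\<close>, produces the discrete moments. The
  equation is stated for a possibly different function \<open>\<Psi>\<close> on the left, so that it serves both the
  multiscaling function and the multiwavelets.
\<close>

lemma continuous_moment_refinement:
  fixes \<Phi> \<Psi> :: "real \<Rightarrow> complex^'n"
  assumes int: "\<And>j. integrable lborel (\<lambda>x. (x ^ j) *\<^sub>R \<Phi> x)" and d: "d > 0"
    and \<Psi>: "\<And>x. \<Psi> x = sqrt d *\<^sub>R (\<Sum>k\<in>K. B k *v \<Phi> (d * x - of_int k))"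
  defines "M \<equiv> (\<lambda>j. (1 / sqrt d) *\<^sub>R (\<Sum>k\<in>K. (real_of_int k ^ j) *\<^sub>R B k))"
  shows "integrable lborel (\<lambda>x. (x ^ j) *\<^sub>R \<Psi> x)"
    and "continuous_moment \<Psi> j =
      (1 / d ^ j) *\<^sub>R (\<Sum>l=0..j. real (j choose l) *\<^sub>R (M (j - l) *v continuous_moment \<Phi> l))"
proof -
  have expand: "(x ^ j) *\<^sub>R \<Psi> x = sqrt d *\<^sub>R (\<Sum>k\<in>K. B k *v ((x ^ j) *\<^sub>R \<Phi> (d * x - of_int k)))" for x
    unfolding \<Psi> by (simp add: matrix_vector_scaleR_right scaleR_sum_right mult_ac)
  have has: "has_bochner_integral lborel (\<lambda>x. (x ^ j) *\<^sub>R \<Psi> x)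
     (sqrt d *\<^sub>R (\<Sum>k\<in>K. B k *v ((1 / d ^ Suc j) *\<^sub>R
        (\<Sum>l=0..j. (real (j choose l) * of_int k ^ (j - l)) *\<^sub>R continuous_moment \<Phi> l))))"
    unfolding expand
    by (intro has_bochner_integral_scaleR_right has_bochner_integral_sum
          has_bochner_integral_bounded_linear[OF matrix_vector_mul_bounded_linear]
          has_moment_dilated_shift int d)
  show "integrable lborel (\<lambda>x. (x ^ j) *\<^sub>R \<Psi> x)"
    using has by (rule integrable.intros)
  have sq: "sqrt d / d ^ Suc j = 1 / d ^ j * (1 / sqrt d)"
  proof -
    have "sqrt d / d ^ Suc j = (sqrt d / d) * (1 / d ^ j)" by simp
    also have "sqrt d / d = 1 / sqrt d"
      using d by (simp add: field_simps)
    finally show ?thesis by simp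
  qed
  have "continuous_moment \<Psi> j = (sqrt d / d ^ Suc j) *\<^sub>R (\<Sum>k\<in>K. \<Sum>l=0..j.
      (real (j choose l) * of_int k ^ (j - l)) *\<^sub>R (B k *v continuous_moment \<Phi> l))"
    unfolding continuous_moment_def[of \<Psi>] has_bochner_integral_integral_eq[OF has]
    by (simp add: matrix_vector_scaleR_right matrix_vector_sum_right scaleR_sum_right)
  also have "\<dots> = (1 / d ^ j) *\<^sub>R (\<Sum>l=0..j. real (j choose l) *\<^sub>R (M (j - l) *v continuous_moment \<Phi> l))"
    unfolding M_def sq
    by (subst sum.swap)
       (simp add: matrix_vector_scaleR_left matrix_vector_sum_left scaleR_sum_right mult_ac)
  finally show "continuous_moment \<Psi> j = \<dots>" .
qed

section \<open>Eigenvalues of the zeroth discrete moment\<close>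

lemma invertible_above_spectral_radius:
  fixes A :: "complex^'n^'n"
  assumes "\<And>z. is_eigenvalue A z \<Longrightarrow> cmod z \<le> 1" "c > 1"
  shows "invertible (c *\<^sub>R mat 1 - A)"
  unfolding invertible_left_inverse matrix_left_invertible_ker
proof (intro allI impI)
  fix x :: "complex^'n"
  assume "(c *\<^sub>R mat 1 - A) *v x = 0"
  then have "A *v x = c *\<^sub>R x"
    by (simp add: matrix_vector_mult_diff_rdistrib matrix_vector_scaleR_left)
  also have "\<dots> = complex_of_real c *s x"
    by (simp only: vec_eq_iff vector_scaleR_component vector_smult_component)
       (simp add: scaleR_conv_of_real)
  finally have "A *v x = complex_of_real c *s x" .
  then have "is_eigenvalue A (complex_of_real c) \<or> x = 0"
    unfolding is_eigenvalue_def by blast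
  then show "x = 0"
    using assms by force
qed

text \<open>
  Condition E speaks of the blocks with index \<open>k\<close> only, the zeroth discrete moment has \<open>-k\<close> in its
  lower blocks. The two matrices agree because each block is summed over all integers.
\<close>

lemma condition_E_eigenvalue_bound:
  assumes "condition_E d Pp Pm" and P: "real_finite_coeffs Pp" "real_finite_coeffs Pm"
    and "is_eigenvalue (discrete_moment d Pp Pm 0) z"
  shows "cmod z \<le> 1"
proof -
  obtain K where K: "finite K" "\<And>k. k \<notin> K \<Longrightarrow> Pp k = 0 \<and> Pm k = 0" "\<And>k. - k \<in> K \<longleftrightarrow> k \<in> K"
    using obtain_symmetric_support[OF P] by metis
  have refl: "(\<Sum>k\<in>K. C (- k)) = (\<Sum>k\<in>K. C k)" for C :: "int \<Rightarrow> complex^'a^'a"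
    by (rule sum.reindex_bij_witness[where i = uminus and j = uminus]) (use K in auto)
  have nth: "(\<Sum>k\<in>K. C (- k) $ a $ b) = (\<Sum>k\<in>K. C k $ a $ b)" for C :: "int \<Rightarrow> complex^'a^'a" and a b
    using arg_cong[OF refl[of C], of "\<lambda>A. A $ a $ b"] by simp
  have "(\<Sum>k\<in>K. stacked_coeff Pp Pm k) = (\<Sum>k\<in>K. block_matrix (Pp k) (Pm k) (Pm k) (Pp k))"
    by (simp add: vec_eq_iff split_sum_all stacked_coeff_def block_matrix_def nth)
  also have "\<dots> = (\<Sum>\<^sub>\<infinity>k\<in>UNIV. block_matrix (Pp k) (Pm k) (Pm k) (Pp k))"
    by (rule infsum_eq_finite_sum[symmetric]) (use K in auto)
  finally have "condition_E_matrix (discrete_moment d Pp Pm 0)"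
    using assms(1) by (simp add: condition_E_def discrete_moment_finite_sum[OF K])
  then show ?thesis
    using assms(4) unfolding condition_E_matrix_def by fastforce
qed

section \<open>Compactly supported functions\<close>

lemma compact_support_bound:
  assumes "has_compact_support f"
  obtains R :: nat where "\<And>x. \<bar>x\<bar> > real R \<Longrightarrow> f x = 0"
proof -
  have "bounded {x. f x \<noteq> 0}"
    using assms bounded_subset[OF compact_imp_bounded closure_subset]
    unfolding has_compact_support_def by blast
  then obtain B where "\<forall>x\<in>{x. f x \<noteq> 0}. \<bar>x\<bar> \<le> B"
    unfolding bounded_real by blast
  moreover obtain R :: nat where "B \<le> real R"
    using real_arch_simple by blast
  ultimately show ?thesis
    by (intro that[of R]) (metis (mono_tags, lifting) mem_Collect_eq not_le order_trans)
qed

lemma integrable_continuous_bounded_support: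
  fixes f :: "real \<Rightarrow> 'b::{banach, second_countable_topology}"
  assumes "continuous_on UNIV f" "\<And>x. \<bar>x\<bar> > R \<Longrightarrow> f x = 0"
  shows "integrable lborel f"
proof -
  have "integrable lborel (\<lambda>x. indicator {-R..R} x *\<^sub>R f x)"
    by (rule borel_integrable_compact) (use assms(1) continuous_on_subset in auto)
  also have "(\<lambda>x. indicator {-R..R} x *\<^sub>R f x) = f"
    using assms(2) by (force simp: indicator_def fun_eq_iff abs_le_iff not_le)
  finally show ?thesis .
qed

section \<open>Best approximation by finite orthonormal families\<close>

text \<open>
  The completed square of Hilbert space geometry. With \<open>a = c\<close> it yields Bessel's inequality, and
  for general \<open>a\<close> it shows that no linear combination approximates \<open>f\<close> better than the orthogonal
  projection; both consequences are used below.
\<close>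

lemma orthonormal_expansion_error:
  fixes e :: "'i \<Rightarrow> 'a \<Rightarrow> complex"
  assumes I: "finite I"
    and f: "integrable M (\<lambda>x. (cmod (f x))\<^sup>2)"
    and fe: "\<And>i. i \<in> I \<Longrightarrow> has_bochner_integral M (\<lambda>x. f x * cnj (e i x)) (c i)"
    and ee: "\<And>i j. i \<in> I \<Longrightarrow> j \<in> I \<Longrightarrow>
      has_bochner_integral M (\<lambda>x. e i x * cnj (e j x)) (if i = j then 1 else 0)"
  shows "(LINT x|M. (cmod (f x - (\<Sum>i\<in>I. a i * e i x)))\<^sup>2) =
    (LINT x|M. (cmod (f x))\<^sup>2) - (\<Sum>i\<in>I. (cmod (c i))\<^sup>2) + (\<Sum>i\<in>I. (cmod (c i - a i))\<^sup>2)"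
proof -
  let ?F = "complex_of_real (LINT x|M. (cmod (f x))\<^sup>2)"
  have expand: "complex_of_real ((cmod (f x - (\<Sum>i\<in>I. a i * e i x)))\<^sup>2) =
      complex_of_real ((cmod (f x))\<^sup>2) - (\<Sum>i\<in>I. cnj (a i) * (f x * cnj (e i x)))
      - (\<Sum>i\<in>I. a i * cnj (f x * cnj (e i x)))
      + (\<Sum>j\<in>I. \<Sum>i\<in>I. (a i * cnj (a j)) * (e i x * cnj (e j x)))" for x
    unfolding complex_norm_square
    by (simp add: algebra_simps sum_product sum_distrib_left sum_distrib_right)
  have has: "has_bochner_integral M (\<lambda>x. complex_of_real ((cmod (f x - (\<Sum>i\<in>I. a i * e i x)))\<^sup>2))
     (?F - (\<Sum>i\<in>I. cnj (a i) * c i) - (\<Sum>i\<in>I. a i * cnj (c i))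
      + (\<Sum>j\<in>I. \<Sum>i\<in>I. (a i * cnj (a j)) * (if i = j then 1 else 0)))"
    unfolding expand
    by (intro has_bochner_integral_add has_bochner_integral_diff has_bochner_integral_sum
        has_bochner_integral_mult_right has_bochner_integral_of_real
        has_bochner_integral_integrable f has_bochner_integral_bounded_linear[OF bounded_linear_cnj] fe ee)
  have "(\<Sum>j\<in>I. \<Sum>i\<in>I. (a i * cnj (a j)) * (if i = j then 1 else 0)) = (\<Sum>i\<in>I. a i * cnj (a i))"
    using I by (simp add: if_distrib[where f = "\<lambda>x. _ * x"] cong: if_cong)
  then have "?F - (\<Sum>i\<in>I. cnj (a i) * c i) - (\<Sum>i\<in>I. a i * cnj (c i))
      + (\<Sum>j\<in>I. \<Sum>i\<in>I. (a i * cnj (a j)) * (if i = j then 1 else 0))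
    = ?F - (\<Sum>i\<in>I. c i * cnj (c i)) + (\<Sum>i\<in>I. (c i - a i) * cnj (c i - a i))"
    by (simp add: algebra_simps sum.distrib sum_subtractf)
  also have "\<dots> = complex_of_real ((LINT x|M. (cmod (f x))\<^sup>2) - (\<Sum>i\<in>I. (cmod (c i))\<^sup>2)
      + (\<Sum>i\<in>I. (cmod (c i - a i))\<^sup>2))"
    by (simp only: of_real_add of_real_diff of_real_sum complex_norm_square)
  finally have "complex_of_real (LINT x|M. (cmod (f x - (\<Sum>i\<in>I. a i * e i x)))\<^sup>2)
     = complex_of_real ((LINT x|M. (cmod (f x))\<^sup>2) - (\<Sum>i\<in>I. (cmod (c i))\<^sup>2)
      + (\<Sum>i\<in>I. (cmod (c i - a i))\<^sup>2))"
    unfolding has_bochner_integral_integral_eq[OF has, symmetric] integral_complex_of_real .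
  then show ?thesis
    using of_real_eq_iff by blast
qed

section \<open>Coefficients of the unit interval\<close>

text \<open>
  The coefficient of the indicator function of \<open>[0, 1]\<close> with respect to \<open>\<surd>D g(D x - k)\<close>, after the
  substitution \<open>y = D x - k\<close>.
\<close>

definition unit_coeff :: "(real \<Rightarrow> complex) \<Rightarrow> real \<Rightarrow> int \<Rightarrow> complex" where
  "unit_coeff g D k = (LINT y|lborel. indicator {- of_int k..D - of_int k} y * cnj (g y)) / sqrt D"

lemma integrable_indicator_mult:
  fixes g :: "real \<Rightarrow> complex"
  assumes "integrable lborel g" "A \<in> sets borel"
  shows "integrable lborel (\<lambda>y. indicator A y * g y)"
proof -
  have "integrable lborel (\<lambda>y. indicator A y *\<^sub>R g y)"
    using assms by (intro integrable_mult_indicator) auto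
  moreover have "(\<lambda>y. indicator A y *\<^sub>R g y) = (\<lambda>y. indicator A y * g y)"
    by (auto simp: indicator_def)
  ultimately show ?thesis by simp
qed

lemma has_unit_coeff:
  fixes g :: "real \<Rightarrow> complex"
  assumes g: "integrable lborel g" and D: "D > 0"
  shows "has_bochner_integral lborel
    (\<lambda>x. indicator {0..1} x * cnj (sqrt D * g (D * x - of_int k))) (unit_coeff g D k)"
proof -
  have "has_bochner_integral lborel (\<lambda>y. indicator {- of_int k..D - of_int k} y * cnj (g y))
      (LINT y|lborel. indicator {- of_int k..D - of_int k} y * cnj (g y))"
    using g by (intro has_bochner_integral_integrable integrable_indicator_mult) auto
  then have "has_bochner_integral lborel
      (\<lambda>x. indicator {- of_int k..D - of_int k} (- of_int k + D * x) * cnj (g (- of_int k + D * x)))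
      ((LINT y|lborel. indicator {- of_int k..D - of_int k} y * cnj (g y)) /\<^sub>R \<bar>D\<bar>)"
    using D by (subst (asm) lborel_has_bochner_integral_real_affine_iff[of D _ _ "- of_int k"]) auto
  then have *: "has_bochner_integral lborel
      (\<lambda>x. sqrt D * (indicator {- of_int k..D - of_int k} (- of_int k + D * x) * cnj (g (- of_int k + D * x))))
      (sqrt D * ((LINT y|lborel. indicator {- of_int k..D - of_int k} y * cnj (g y)) /\<^sub>R \<bar>D\<bar>))"
    by (intro has_bochner_integral_mult_right)
  have scale: "sqrt D * (z /\<^sub>R \<bar>D\<bar>) = z / sqrt D" for z :: complex
  proof -
    have "complex_of_real (sqrt D) * complex_of_real (sqrt D) = complex_of_real D"
      using D by (simp flip: of_real_mult)
    then show ?thesis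
      using D by (auto simp: scaleR_conv_of_real divide_simps)
  qed
  have dilate: "indicator {- of_int k..D - of_int k} (- of_int k + D * x) = (indicator {0..1} x :: complex)" for x
    using D by (auto simp: indicator_def zero_le_mult_iff)
  show ?thesis
    using * unfolding scale dilate unit_coeff_def by (simp add: mult_ac)
qed

text \<open>
  The window \<open>[-k, D - k]\<close> contains the whole support of \<open>g\<close>, so the coefficient sees the full
  integral.
\<close>

lemma unit_coeff_interior:
  assumes supp: "\<And>x. \<bar>x\<bar> > real R \<Longrightarrow> g x = 0" and k: "k \<in> {int R..int D - int R}"
  shows "unit_coeff g (real D) k = cnj (LINT y|lborel. g y) / sqrt (real D)"
proof -
  have "real R \<le> of_int k" "of_int k \<le> real D - real R"
    using k unfolding atLeastAtMost_iff by linarith+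
  then have full: "indicator {- of_int k..real D - of_int k} y * cnj (g y) = cnj (g y)" for y
    using supp[of y] by (cases "\<bar>y\<bar> > real R") (auto simp: indicator_def)
  then show ?thesis
    unfolding unit_coeff_def full by simp
qed

lemma unit_coeff_exterior:
  assumes supp: "\<And>x. \<bar>x\<bar> > real R \<Longrightarrow> g x = 0" and k: "k \<notin> {- int R..int D + int R}"
  shows "unit_coeff g (real D) k = 0"
proof -
  have "real_of_int k < - real R \<or> real_of_int k > real D + real R"
    using k unfolding atLeastAtMost_iff by linarith
  then have empty: "indicator {- of_int k..real D - of_int k} y * cnj (g y) = 0" for y
    using supp[of y] by (cases "\<bar>y\<bar> > real R") (auto simp: indicator_def)
  then show ?thesis
    unfolding unit_coeff_def empty by simp
qed

text \<open>
  A crude bound, sufficient for the translates whose support may meet an end point of the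
  interval.
\<close>

lemma unit_coeff_bound:
  assumes g: "integrable lborel g" and D: "D > 0"
  shows "(cmod (unit_coeff g D k))\<^sup>2 \<le> (LINT y|lborel. cmod (g y))\<^sup>2 / D"
proof -
  have "cmod (LINT y|lborel. indicator {- of_int k..D - of_int k} y * cnj (g y))
      \<le> (LINT y|lborel. cmod (indicator {- of_int k..D - of_int k} y * cnj (g y)))"
    by (rule integral_norm_bound)
  also have "\<dots> \<le> (LINT y|lborel. cmod (g y))"
    using g by (intro integral_mono integrable_norm integrable_indicator_mult)
      (auto simp: norm_mult indicator_def)
  finally show ?thesis
    using D by (simp add: unit_coeff_def norm_divide power_divide power_mono divide_right_mono)
qed

lemma sum_unit_coeff_interior:
  assumes "\<And>x. \<bar>x\<bar> > real R \<Longrightarrow> g x = 0" "0 < R" "2 * R \<le> D"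
  shows "(\<Sum>k\<in>{int R..int D - int R}. (cmod (unit_coeff g (real D) k))\<^sup>2) =
    (real D - 2 * real R + 1) / real D * (cmod (LINT y|lborel. g y))\<^sup>2"
proof -
  have "(\<Sum>k\<in>{int R..int D - int R}. (cmod (unit_coeff g (real D) k))\<^sup>2)
     = real (card {int R..int D - int R}) * ((cmod (LINT y|lborel. g y))\<^sup>2 / real D)"
    by (simp add: unit_coeff_interior[OF assms(1)] norm_divide power_divide cong: sum.cong_simp)
  also have "real (card {int R..int D - int R}) = real D - 2 * real R + 1"
    using assms by simp
  finally show ?thesis by simp
qed

text \<open>
  At most \<open>4 R\<close> translates straddle an end point, independently of \<open>D\<close>, and each contributes
  \<open>O(1/D)\<close>; so their contribution vanishes as \<open>D\<close> grows. At most \<open>D\<close> translates lie inside the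
  interval, each contributing \<open>1/D\<close> times the squared modulus of the integral; those outside
  contribute nothing.
\<close>

lemma sum_unit_coeff_le:
  assumes g: "integrable lborel g" and supp: "\<And>x. \<bar>x\<bar> > real R \<Longrightarrow> g x = 0"
    and R: "0 < R" "2 * R \<le> D" and K: "finite K"
  shows "(\<Sum>k\<in>K. (cmod (unit_coeff g (real D) k))\<^sup>2) \<le>
    (cmod (LINT y|lborel. g y))\<^sup>2 + 4 * real R * (LINT y|lborel. cmod (g y))\<^sup>2 / real D"
proof -
  let ?c = "\<lambda>k. (cmod (unit_coeff g (real D) k))\<^sup>2"
  let ?B = "{- int R..int D + int R}" and ?C = "{int R..int D - int R}"
  have sub: "?C \<subseteq> ?B" by auto
  have "(\<Sum>k\<in>K. ?c k) = (\<Sum>k\<in>K \<inter> ?B. ?c k)"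
    using K by (intro sum.mono_neutral_right) (auto simp: unit_coeff_exterior[OF supp] simp del: atLeastAtMost_iff)
  also have "\<dots> \<le> (\<Sum>k\<in>?B. ?c k)"
    by (rule sum_mono2) auto
  also have "\<dots> = (\<Sum>k\<in>?B - ?C. ?c k) + (\<Sum>k\<in>?C. ?c k)"
    by (rule sum.subset_diff[OF sub]) simp
  also have "(\<Sum>k\<in>?B - ?C. ?c k) \<le> real (card (?B - ?C)) * ((LINT y|lborel. cmod (g y))\<^sup>2 / real D)"
    using unit_coeff_bound[OF g, of "real D"] R by (intro sum_bounded_above) auto
  also have "real (card (?B - ?C)) = 4 * real R"
    using R sub by (simp add: card_Diff_subset of_nat_diff)
  also have "(\<Sum>k\<in>?C. ?c k) \<le> (cmod (LINT y|lborel. g y))\<^sup>2"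
  proof -
    have "(\<Sum>k\<in>?C. ?c k) = (real D - 2 * real R + 1) / real D * (cmod (LINT y|lborel. g y))\<^sup>2"
      using supp R by (rule sum_unit_coeff_interior)
    also have "\<dots> \<le> (cmod (LINT y|lborel. g y))\<^sup>2"
      using R by (intro mult_left_le_one_le) (auto simp: field_simps)
    finally show ?thesis .
  qed
  finally show ?thesis by simp
qed

section \<open>The total mass of a dense orthonormal family\<close>

lemma has_bochner_integral_dilate_sqrt:
  fixes f :: "real \<Rightarrow> complex"
  assumes "has_bochner_integral lborel f z" "D > 0"
  shows "has_bochner_integral lborel (\<lambda>x. sqrt D * (sqrt D * f (D * x))) z"
proof -
  have "has_bochner_integral lborel (\<lambda>x. f (0 + D * x)) (z /\<^sub>R \<bar>D\<bar>)"
    using assms by (subst (asm) lborel_has_bochner_integral_real_affine_iff[of D _ _ 0]) auto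
  then have "has_bochner_integral lborel (\<lambda>x. complex_of_real D * f (0 + D * x))
      (complex_of_real D * (z /\<^sub>R \<bar>D\<bar>))"
    by (intro has_bochner_integral_mult_right)
  moreover have "complex_of_real D * (z /\<^sub>R \<bar>D\<bar>) = z"
    using assms(2) by (simp add: scaleR_conv_of_real)
  moreover have expand: "complex_of_real D * f (0 + D * x) = sqrt D * (sqrt D * f (D * x))" for x
  proof -
    have "complex_of_real D = complex_of_real (sqrt D) * complex_of_real (sqrt D)"
      using assms(2) by (simp flip: of_real_mult)
    then show ?thesis by (metis add_0 mult.assoc)
  qed
  ultimately show ?thesis unfolding expand by metis
qed

text \<open>
  The squared norm of the indicator of \<open>[0, 1]\<close> is 1. Its orthogonal projection onto the closed
  span of the components of all \<open>\<Phi>(D x - k)\<close>, where \<open>D = d\<^sup>n\<close>, has squared norm \<open>S + O(1/D)\<close>,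
  where \<open>S\<close> is the left-hand side of the conclusion. Bessel's inequality gives \<open>S \<le> 1\<close>, and
  density of the spans gives \<open>S \<ge> 1\<close>.
\<close>

lemma integral_norm_square_eq_one:
  fixes \<Phi> :: "real \<Rightarrow> complex^'n" and d :: nat
  assumes d: "d \<ge> 2" and cont: "continuous_on UNIV \<Phi>" and supp: "\<And>x. \<bar>x\<bar> > real R \<Longrightarrow> \<Phi> x = 0"
    and orth: "\<And>j k i l. (LINT x|lborel. \<Phi> (x - of_int j) $ i * cnj (\<Phi> (x - of_int k) $ l)) =
        (if j = k \<and> i = l then 1 else 0)"
    and dense: "\<And>\<epsilon> N. \<epsilon> > 0 \<Longrightarrow> \<exists>n\<ge>N. \<exists>K A. finite K \<and>
        (LINT x|lborel. (cmod (indicator {0..1} x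
           - (\<Sum>k\<in>K. \<Sum>i\<in>UNIV. A k $ i * \<Phi> (real d ^ n * x - of_int k) $ i)))\<^sup>2) \<le> \<epsilon>"
  shows "(\<Sum>i\<in>UNIV. (cmod (LINT x|lborel. \<Phi> x $ i))\<^sup>2) = 1"
proof -
  define S where "S = (\<Sum>i\<in>UNIV. (cmod (LINT x|lborel. \<Phi> x $ i))\<^sup>2)"
  define C where "C = (\<Sum>i\<in>UNIV. (LINT x|lborel. cmod (\<Phi> x $ i))\<^sup>2)"
  \<comment> \<open>A positive support radius, so that at most \<open>D\<close> translates see the full integral.\<close>
  define T where "T = Suc R"
  have T: "0 < T" and suppT: "\<And>x i. \<bar>x\<bar> > real T \<Longrightarrow> \<Phi> x $ i = 0"
    using supp by (auto simp: T_def)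
  have cont_i: "continuous_on UNIV (\<lambda>x. \<Phi> (x - t) $ i)" for t i
    by (intro bounded_linear.continuous_on[OF bounded_linear_vec_nth] continuous_on_compose2[OF cont]
        continuous_intros) simp
  have int_i: "integrable lborel (\<lambda>x. \<Phi> x $ i)" for i
    using cont_i[of 0] suppT by (intro integrable_continuous_bounded_support[of _ "real T"]) auto
  let ?f = "indicator {0..1} :: real \<Rightarrow> complex"
  have fsq: "(\<lambda>x. (cmod (?f x))\<^sup>2) = (indicator {0..1} :: real \<Rightarrow> real)"
    by (auto simp: indicator_def)
  have f_int: "integrable lborel (\<lambda>x. (cmod (?f x))\<^sup>2)" and f_one: "(LINT x|lborel. (cmod (?f x))\<^sup>2) = 1"
    unfolding fsq by simp_all
  let ?e = "\<lambda>D p x. sqrt (real D) * \<Phi> (real D * x - of_int (fst p)) $ snd p"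
  let ?c = "\<lambda>D p. unit_coeff (\<lambda>x. \<Phi> x $ snd p) (real D) (fst p)"
  have error: "(LINT x|lborel. (cmod (?f x - (\<Sum>p\<in>I. a p * ?e D p x)))\<^sup>2) =
      (LINT x|lborel. (cmod (?f x))\<^sup>2) - (\<Sum>p\<in>I. (cmod (?c D p))\<^sup>2) + (\<Sum>p\<in>I. (cmod (?c D p - a p))\<^sup>2)"
    if I: "finite I" and D: "D > 0" for I a D
  proof (rule orthonormal_expansion_error[OF I f_int])
    show "has_bochner_integral lborel (\<lambda>x. ?f x * cnj (?e D p x)) (?c D p)" for p
      using has_unit_coeff[OF int_i] D by simp
    show "has_bochner_integral lborel (\<lambda>x. ?e D p x * cnj (?e D q x)) (if p = q then 1 else 0)" for p q
    proof -
      let ?h = "\<lambda>x. \<Phi> (x - of_int (fst p)) $ snd p * cnj (\<Phi> (x - of_int (fst q)) $ snd q)"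
      have "integrable lborel ?h"
      proof (rule integrable_continuous_bounded_support)
        show "continuous_on UNIV ?h"
          by (intro continuous_intros cont_i)
        show "?h x = 0" if "\<bar>x\<bar> > real T + \<bar>of_int (fst p)\<bar>" for x
          using suppT[of "x - of_int (fst p)" "snd p"] that by auto
      qed
      then have "has_bochner_integral lborel ?h (if p = q then 1 else 0)"
        by (subst has_bochner_integral_iff) (auto simp: orth prod_eq_iff)
      from has_bochner_integral_dilate_sqrt[OF this, of "real D"] show ?thesis
        using D by (simp add: mult_ac)
    qed
  qed
  have grow: "\<exists>N. \<forall>n\<ge>N. X \<le> real (d ^ n)" for X :: real
  proof -
    obtain N where "X < real d ^ N"
      using real_arch_pow[of "real d" X] d by auto
    moreover have "real d ^ N \<le> real d ^ n" if "n \<ge> N" for n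
      using d that by (intro power_increasing) auto
    ultimately show ?thesis
      by (metis less_eq_real_def order_trans of_nat_power)
  qed
  have upper: "S * (real D - 2 * real T + 1) \<le> real D" if D: "2 * T \<le> D" for D
  proof -
    have D0: "D > 0" using D T by simp
    let ?I = "{int T..int D - int T} \<times> (UNIV :: 'n set)"
    have "(\<Sum>p\<in>?I. (cmod (?c D p))\<^sup>2) \<le> 1"
    proof -
      have "0 \<le> (LINT x|lborel. (cmod (?f x - (\<Sum>p\<in>?I. ?c D p * ?e D p x)))\<^sup>2)"
        by (rule integral_nonneg_AE) auto
      then show ?thesis
        using error[of ?I D "?c D"] f_one D0 by simp
    qed
    also have "(\<Sum>p\<in>?I. (cmod (?c D p))\<^sup>2)
       = (\<Sum>i\<in>UNIV. \<Sum>k\<in>{int T..int D - int T}. (cmod (unit_coeff (\<lambda>x. \<Phi> x $ i) (real D) k))\<^sup>2)"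
      by (subst sum.swap) (simp add: sum.cartesian_product case_prod_beta)
    also have "\<dots> = (real D - 2 * real T + 1) / real D * S"
      unfolding S_def sum_distrib_left
      by (intro sum.cong refl sum_unit_coeff_interior suppT T D)
    finally show ?thesis
      using D0 by (simp add: field_simps)
  qed
  have lower: "1 \<le> S + 2 * \<epsilon>" if eps: "\<epsilon> > 0" for \<epsilon>
  proof -
    \<comment> \<open>Levels at which some translates fit inside the interval and the end point terms sum to
      at most \<open>\<epsilon>\<close>.\<close>
    obtain N where N: "\<forall>n\<ge>N. max (2 * real T) (4 * real T * C / \<epsilon>) \<le> real (d ^ n)"
      using grow by blast
    obtain n K A where n: "n \<ge> N" and K: "finite K" and approx:
      "(LINT x|lborel. (cmod (?f x
           - (\<Sum>k\<in>K. \<Sum>i\<in>UNIV. A k $ i * \<Phi> (real d ^ n * x - of_int k) $ i)))\<^sup>2) \<le> \<epsilon>"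
      using dense[OF eps, of N] by blast
    define D where "D = d ^ n"
    have DT: "2 * T \<le> D" and D0: "D > 0" and DC: "4 * real T * C / real D \<le> \<epsilon>"
    proof -
      have "2 * real T \<le> real D" "4 * real T * C / \<epsilon> \<le> real D"
        using N n unfolding D_def by auto
      then show "2 * T \<le> D" "D > 0" "4 * real T * C / real D \<le> \<epsilon>"
        using T eps by (auto simp: field_simps)
    qed
    let ?I = "K \<times> (UNIV :: 'n set)"
    define a where "a = (\<lambda>p. A (fst p) $ snd p / sqrt (real D))"
    have "(\<Sum>k\<in>K. \<Sum>i\<in>UNIV. A k $ i * \<Phi> (real d ^ n * x - of_int k) $ i) = (\<Sum>p\<in>?I. a p * ?e D p x)" for x
      using d by (simp add: sum.cartesian_product case_prod_beta a_def D_def)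
    then have "1 - (\<Sum>p\<in>?I. (cmod (?c D p))\<^sup>2) + (\<Sum>p\<in>?I. (cmod (?c D p - a p))\<^sup>2) \<le> \<epsilon>"
      using approx error[of ?I D a] f_one K D0 by simp
    moreover have "0 \<le> (\<Sum>p\<in>?I. (cmod (?c D p - a p))\<^sup>2)"
      by (rule sum_nonneg) simp
    ultimately have "1 - \<epsilon> \<le> (\<Sum>p\<in>?I. (cmod (?c D p))\<^sup>2)" by linarith
    also have "\<dots> = (\<Sum>i\<in>UNIV. \<Sum>k\<in>K. (cmod (unit_coeff (\<lambda>x. \<Phi> x $ i) (real D) k))\<^sup>2)"
      by (subst sum.swap) (simp add: sum.cartesian_product case_prod_beta)
    also have "\<dots> \<le> (\<Sum>i\<in>UNIV. (cmod (LINT x|lborel. \<Phi> x $ i))\<^sup>2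
        + 4 * real T * (LINT x|lborel. cmod (\<Phi> x $ i))\<^sup>2 / real D)"
      by (intro sum_mono sum_unit_coeff_le int_i suppT T DT K)
    also have "\<dots> = S + 4 * real T * C / real D"
      by (simp add: S_def C_def sum.distrib sum_distrib_left sum_divide_distrib)
    finally show ?thesis using DC by linarith
  qed
  have "1 \<le> S"
  proof (rule field_le_epsilon)
    fix \<epsilon> :: real assume "\<epsilon> > 0"
    then show "1 \<le> S + \<epsilon>" using lower[of "\<epsilon> / 2"] by simp
  qed
  moreover have "S \<le> 1"
  proof (rule ccontr)
    assume "\<not> S \<le> 1"
    then have S: "S > 1" by simp
    obtain N where "\<forall>n\<ge>N. max (2 * real T) (2 * real T * S / (S - 1)) \<le> real (d ^ n)"
      using grow by blast
    then have D: "2 * real T \<le> real (d ^ N)" "2 * real T * S / (S - 1) \<le> real (d ^ N)"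
      by auto
    have "2 * T \<le> d ^ N" using D(1) by linarith
    from upper[OF this] have "real (d ^ N) * (S - 1) + S \<le> 2 * real T * S"
      by (simp add: algebra_simps)
    moreover have "2 * real T * S \<le> real (d ^ N) * (S - 1)"
      using D(2) S by (simp add: field_simps)
    ultimately show False using S by linarith
  qed
  ultimately show ?thesis unfolding S_def by linarith
qed

section \<open>Approximation from the multiresolution spaces\<close>

lemma norm_add_square_le:
  fixes u v :: "'a::real_normed_vector"
  shows "(norm (u + v))\<^sup>2 \<le> 2 * (norm u)\<^sup>2 + 2 * (norm v)\<^sup>2"
proof -
  have "(norm (u + v))\<^sup>2 \<le> (norm u + norm v)\<^sup>2"
    by (intro power_mono norm_triangle_ineq) simp
  also have "\<dots> \<le> 2 * (norm u)\<^sup>2 + 2 * (norm v)\<^sup>2"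
    using sum_squares_bound[of "norm u" "norm v"] by (simp add: power2_sum)
  finally show ?thesis .
qed

lemma L2_cmult: "f \<in> L2 \<Longrightarrow> (\<lambda>x. c * f x) \<in> L2"
  by (auto simp: L2_def norm_mult power_mult_distrib)

lemma L2_add:
  assumes "f \<in> L2" "g \<in> L2"
  shows "(\<lambda>x. f x + g x) \<in> L2"
proof -
  have [measurable]: "f \<in> borel_measurable lborel" "g \<in> borel_measurable lborel"
    using assms by (auto simp: L2_def)
  have "integrable lborel (\<lambda>x. (cmod (f x + g x))\<^sup>2)"
  proof (rule Bochner_Integration.integrable_bound)
    show "integrable lborel (\<lambda>x. 2 * (cmod (f x))\<^sup>2 + 2 * (cmod (g x))\<^sup>2)"
      using assms by (auto simp: L2_def)
    have "(cmod (f x + g x))\<^sup>2 \<le> 2 * (cmod (f x))\<^sup>2 + 2 * (cmod (g x))\<^sup>2" for x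
      by (rule norm_add_square_le)
    then show "AE x in lborel. norm ((cmod (f x + g x))\<^sup>2) \<le> norm (2 * (cmod (f x))\<^sup>2 + 2 * (cmod (g x))\<^sup>2)"
      by (intro AE_I2) simp
  qed simp
  then show ?thesis
    by (simp add: L2_def)
qed

lemma L2_sum: "(\<And>i. i \<in> I \<Longrightarrow> f i \<in> L2) \<Longrightarrow> (\<lambda>x. \<Sum>i\<in>I. f i x) \<in> L2"
proof (induction I rule: infinite_finite_induct)
  case (insert i I)
  then show ?case by (simp add: L2_add)
qed (simp_all add: L2_def)

lemma L2_diff: "f \<in> L2 \<Longrightarrow> g \<in> L2 \<Longrightarrow> (\<lambda>x. f x - g x) \<in> L2"
  using L2_add[of f "\<lambda>x. (- 1) * g x"] L2_cmult[of g "- 1"] by simp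

lemma L2_affine:
  assumes "f \<in> L2" "c \<noteq> 0"
  shows "(\<lambda>x. f (t + c * x)) \<in> L2"
proof -
  have [measurable]: "f \<in> borel_measurable borel"
    using assms by (simp add: L2_def)
  have "(\<lambda>x. f (t + c * x)) \<in> borel_measurable borel"
    by measurable
  moreover have "integrable lborel (\<lambda>x. (cmod (f (t + c * x)))\<^sup>2)"
    using lborel_integrable_real_affine[of "\<lambda>x. (cmod (f x))\<^sup>2" c t] assms by (auto simp: L2_def)
  ultimately show ?thesis by (simp add: L2_def)
qed

lemma level_combination_L2:
  assumes "\<And>i. (\<lambda>x. \<phi> x $ i) \<in> L2" "d > 0"
  shows "level_combination d \<phi> n K a b \<in> L2"
proof -
  have "(\<lambda>x. \<phi> (t + c * x) $ i) \<in> L2" if "c \<noteq> 0" for t c i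
    using L2_affine[OF assms(1)] that .
  from this[of "real d powi n" "- of_int k" i for k i] this[of "- (real d powi n)" "of_int k" i for k i]
  have "(\<lambda>x. \<phi> (real d powi n * x - of_int k) $ i) \<in> L2" "(\<lambda>x. \<phi> (of_int k - real d powi n * x) $ i) \<in> L2" for k i
    using assms(2) by simp_all
  then show ?thesis
    unfolding level_combination_def by (intro L2_sum L2_add L2_cmult)
qed

lemma L2_norm_square: "(L2_norm f)\<^sup>2 = (LINT x|lborel. (cmod (f x))\<^sup>2)"
  unfolding L2_norm_def by (intro real_sqrt_pow2 integral_nonneg_AE) simp

text \<open>
  A substitute for the triangle inequality; its constants do no harm, since the distances become
  arbitrarily small.
\<close>

lemma L2_norm_diff_square_le:
  assumes "f \<in> L2" "g \<in> L2" "h \<in> L2"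
  shows "(L2_norm (\<lambda>x. f x - h x))\<^sup>2 \<le> 2 * (L2_norm (\<lambda>x. f x - g x))\<^sup>2 + 2 * (L2_norm (\<lambda>x. g x - h x))\<^sup>2"
proof -
  have int: "integrable lborel (\<lambda>x. (cmod (f x - h x))\<^sup>2)" "integrable lborel (\<lambda>x. (cmod (f x - g x))\<^sup>2)"
     "integrable lborel (\<lambda>x. (cmod (g x - h x))\<^sup>2)"
    using L2_diff[OF assms(1,3)] L2_diff[OF assms(1,2)] L2_diff[OF assms(2,3)] by (auto simp: L2_def)
  have "(cmod (f x - h x))\<^sup>2 \<le> 2 * (cmod (f x - g x))\<^sup>2 + 2 * (cmod (g x - h x))\<^sup>2" for x
    using norm_add_square_le[of "f x - g x" "g x - h x"] by simp
  then have "(LINT x|lborel. (cmod (f x - h x))\<^sup>2) \<le>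
      (LINT x|lborel. 2 * (cmod (f x - g x))\<^sup>2 + 2 * (cmod (g x - h x))\<^sup>2)"
    using int by (intro integral_mono) auto
  also have "\<dots> = 2 * (LINT x|lborel. (cmod (f x - g x))\<^sup>2) + 2 * (LINT x|lborel. (cmod (g x - h x))\<^sup>2)"
    using int by simp
  finally show ?thesis unfolding L2_norm_square .
qed

text \<open>
  Density of the union supplies some level, nestedness moves to any finer one, so that the limit
  \<open>n \<rightarrow> \<infinity>\<close> can be taken in the normalization argument.
\<close>

lemma MRA_fine_approximation:
  assumes mra: "generates_MRA d \<phi>" and d: "d > 0" and f: "f \<in> L2" and eps: "\<epsilon> > 0"
  shows "\<exists>n\<ge>N. \<exists>K a b. finite K \<and>
    (LINT x|lborel. (cmod (f x - level_combination d \<phi> (int n) K a b x))\<^sup>2) \<le> \<epsilon>"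
proof -
  have comp: "\<And>i. (\<lambda>x. \<phi> x $ i) \<in> L2"
    and nested: "\<And>n. level_space d \<phi> n \<subseteq> level_space d \<phi> (n + 1)"
    and dense: "\<And>f e. f \<in> L2 \<Longrightarrow> e > 0 \<Longrightarrow> \<exists>n. \<exists>g\<in>level_space d \<phi> n. L2_norm (\<lambda>x. f x - g x) < e"
    using mra unfolding generates_MRA_def by - (elim conjE, simp)+
  have nested': "level_space d \<phi> n \<subseteq> level_space d \<phi> (n + int m)" for n m
  proof (induction m)
    case (Suc m)
    then show ?case using nested[of "n + int m"] by (simp add: add_ac) 
  qed simp
  \<comment> \<open>Two errors below \<open>\<eta>\<close> add up to a squared error of at most \<open>2\<eta>\<^sup>2 + 2\<eta>\<^sup>2 = \<epsilon>\<close>.\<close>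
  define \<eta> where "\<eta> = sqrt (\<epsilon> / 4)"
  have eta: "\<eta> > 0" "\<eta>\<^sup>2 = \<epsilon> / 4"
    using eps by (simp_all add: \<eta>_def)
  obtain n\<^sub>0 g where g: "g \<in> level_space d \<phi> n\<^sub>0" and fg: "L2_norm (\<lambda>x. f x - g x) < \<eta>"
    using dense[OF f eta(1)] by blast
  define n where "n = max N (nat n\<^sub>0)"
  have "int n = n\<^sub>0 + int (nat (int n - n\<^sub>0))"
    unfolding n_def by linarith
  then have "g \<in> level_space d \<phi> (int n)"
    using nested'[of n\<^sub>0 "nat (int n - n\<^sub>0)"] g by auto
  then obtain K a b where gL2: "g \<in> L2" and K: "finite K"
    and gh: "L2_norm (\<lambda>x. g x - level_combination d \<phi> (int n) K a b x) < \<eta>"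
    using eta(1) unfolding level_space_def by blast
  have nonneg: "L2_norm u \<ge> 0" for u
    unfolding L2_norm_def by (intro real_sqrt_ge_zero integral_nonneg_AE) simp
  have "(L2_norm (\<lambda>x. f x - g x))\<^sup>2 \<le> \<epsilon> / 4"
    "(L2_norm (\<lambda>x. g x - level_combination d \<phi> (int n) K a b x))\<^sup>2 \<le> \<epsilon> / 4"
    using fg gh nonneg unfolding eta(2)[symmetric] by (auto intro!: power_mono simp: less_imp_le)
  moreover have "level_combination d \<phi> (int n) K a b \<in> L2"
    using level_combination_L2[OF comp d] .
  ultimately have "(L2_norm (\<lambda>x. f x - level_combination d \<phi> (int n) K a b x))\<^sup>2 \<le> \<epsilon>"
    using L2_norm_diff_square_le[OF f gL2, of "level_combination d \<phi> (int n) K a b"] by linarith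
  moreover have "n \<ge> N" by (simp add: n_def)
  ultimately show ?thesis
    using K unfolding L2_norm_square by blast
qed

lemma level_combination_stacked:
  "level_combination d \<phi> (int n) K a b x =
    (\<Sum>k\<in>K. \<Sum>i\<in>UNIV. stack_vec (a k) (b k) $ i * two_sided \<phi> (real d ^ n * x - of_int k) $ i)"
  by (simp add: level_combination_def two_sided_def sum_UNIV_Plus sum.distrib)

section \<open>Two-sided functions\<close>

lemma two_sided_nth [simp]:
  "two_sided f x $ Inl a = f x $ a" "two_sided f x $ Inr a = f (- x) $ a"
  by (simp_all add: two_sided_def)

lemma continuous_on_two_sided:
  fixes f :: "real \<Rightarrow> complex^'r"
  assumes "continuous_on UNIV f"
  shows "continuous_on UNIV (two_sided f)"
proof -
  have nth: "continuous_on UNIV (\<lambda>x. f (c * x) $ a)" for a c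
    by (intro bounded_linear.continuous_on[OF bounded_linear_vec_nth]
        continuous_on_compose2[OF assms] continuous_intros) simp
  have "continuous_on UNIV (\<lambda>x. two_sided f x $ i)" for i
    using nth[of 1] nth[of "- 1"] by (cases i) simp_all
  then have "continuous_on UNIV (\<lambda>x. \<chi> i. two_sided f x $ i)"
    by (intro continuous_on_vec_lambda)
  then show ?thesis by simp
qed

text \<open>
  Of the four pairs of halves, two are the hypotheses themselves, the pair lower-upper is the
  conjugate of upper-lower, and lower-lower is upper-upper after the reflection \<open>x \<mapsto> -x\<close>.
\<close>

lemma two_sided_orthonormal:
  fixes \<phi> :: "real \<Rightarrow> complex^'r"
  assumes "two_direction_orthogonal \<phi>"
  shows "(LINT x|lborel. two_sided \<phi> (x - of_int j) $ i * cnj (two_sided \<phi> (x - of_int k) $ l)) =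
    (if j = k \<and> i = l then 1 else 0)"
proof -
  have same: "(LINT x|lborel. \<phi> (x - of_int j) $ a * cnj (\<phi> (x - of_int k) $ b)) =
      (if j = k \<and> a = b then 1 else 0)" for j k a b
  proof -
    have "matrix_inner (\<lambda>x. \<phi> (x - of_int j)) (\<lambda>x. \<phi> (x - of_int k)) $ a $ b
       = (if j = k then mat 1 else 0) $ a $ b"
      using assms by (simp add: two_direction_orthogonal_def)
    then show ?thesis by (auto simp: matrix_inner_def mat_def)
  qed
  have opposite: "(LINT x|lborel. \<phi> (x - of_int j) $ a * cnj (\<phi> (of_int k - x) $ b)) = 0" for j k a b
  proof -
    have "matrix_inner (\<lambda>x. \<phi> (x - of_int j)) (\<lambda>x. \<phi> (of_int k - x)) $ a $ b = 0 $ a $ b"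
      using assms by (simp add: two_direction_orthogonal_def)
    then show ?thesis by (simp add: matrix_inner_def)
  qed
  have opposite': "(LINT x|lborel. \<phi> (of_int j - x) $ a * cnj (\<phi> (x - of_int k) $ b)) = 0" for j k a b
  proof -
    have "(LINT x|lborel. \<phi> (of_int j - x) $ a * cnj (\<phi> (x - of_int k) $ b))
      = (LINT x|lborel. cnj (\<phi> (x - of_int k) $ b * cnj (\<phi> (of_int j - x) $ a)))"
      by (simp add: mult.commute)
    also have "\<dots> = cnj (LINT x|lborel. \<phi> (x - of_int k) $ b * cnj (\<phi> (of_int j - x) $ a))"
      by (rule Bochner_Integration.integral_cnj)
    also have "\<dots> = 0"
      by (simp only: opposite complex_cnj_zero)
    finally show ?thesis .
  qed
  have reflected: "(LINT x|lborel. \<phi> (of_int j - x) $ a * cnj (\<phi> (of_int k - x) $ b)) =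
      (if j = k \<and> a = b then 1 else 0)" for j k a b
  proof -
    have "(LINT x|lborel. \<phi> (of_int j - x) $ a * cnj (\<phi> (of_int k - x) $ b))
      = (LINT x|lborel. \<phi> (x - of_int (- j)) $ a * cnj (\<phi> (x - of_int (- k)) $ b))"
      using lborel_integral_real_affine[of "- 1"
          "\<lambda>x. \<phi> (of_int j - x) $ a * cnj (\<phi> (of_int k - x) $ b)" 0]
      by (simp add: add.commute)
    then show ?thesis by (simp only: same neg_equal_iff_equal)
  qed
  show ?thesis
    by (cases i; cases l) (simp_all add: same opposite opposite' reflected)
qed

lemma moment_nth:
  assumes "integrable lborel (\<lambda>x. (x ^ j) *\<^sub>R f x)"
  shows "continuous_moment f j $ i = (LINT x|lborel. (x ^ j) *\<^sub>R f x $ i)"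
  unfolding continuous_moment_def
  using integral_bounded_linear[OF bounded_linear_vec_nth assms, of i] by simp

lemma continuous_moment_upper_half:
  fixes f :: "real \<Rightarrow> complex^'r"
  assumes "integrable lborel (\<lambda>x. (x ^ j) *\<^sub>R two_sided f x)"
  shows "continuous_moment f j = upper_half (continuous_moment (two_sided f) j)"
proof -
  have "linear (upper_half :: complex^('r + 'r) \<Rightarrow> complex^'r)"
    by (rule linearI) (simp_all add: upper_half_def vec_eq_iff)
  then have bl: "bounded_linear (upper_half :: complex^('r + 'r) \<Rightarrow> complex^'r)"
    by (simp add: linear_conv_bounded_linear)
  have "upper_half ((x ^ j) *\<^sub>R two_sided f x) = (x ^ j) *\<^sub>R f x" for x
    by (simp add: upper_half_def vec_eq_iff)
  then show ?thesis
    unfolding continuous_moment_def using integral_bounded_linear[OF bl assms] by simp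
qed

section \<open>The normalization of the zeroth moment\<close>

lemma moment_zero_normalized:
  fixes \<phi> :: "real \<Rightarrow> complex^'r"
  assumes d: "d \<ge> 2" and mra: "generates_MRA d \<phi>" and orth: "two_direction_orthogonal \<phi>"
    and supp: "has_compact_support \<phi>" and cont: "continuous_on UNIV \<phi>"
  shows "conj_dot (continuous_moment (two_sided \<phi>) 0) (continuous_moment (two_sided \<phi>) 0) = 1"
proof -
  obtain R :: nat where R: "\<And>x. \<bar>x\<bar> > real R \<Longrightarrow> \<phi> x = 0"
    using compact_support_bound[OF supp] by blast
  have R': "two_sided \<phi> x = 0" if "\<bar>x\<bar> > real R" for x
    using that by (simp add: vec_eq_iff split_sum_all R)
  have cont': "continuous_on UNIV (two_sided \<phi>)"
    using cont by (rule continuous_on_two_sided)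
  have L2: "(indicator {0..1} :: real \<Rightarrow> complex) \<in> L2"
  proof -
    have "(\<lambda>x. (cmod (indicator {0..1} x))\<^sup>2) = (indicator {0..1} :: real \<Rightarrow> real)"
      by (auto simp: indicator_def)
    then show ?thesis by (simp add: L2_def)
  qed
  have "(\<Sum>i\<in>UNIV. (cmod (LINT x|lborel. two_sided \<phi> x $ i))\<^sup>2) = 1"
  proof (rule integral_norm_square_eq_one[OF d cont' R' two_sided_orthonormal[OF orth]])
    fix \<epsilon> :: real and N :: nat assume eps: "\<epsilon> > 0"
    show "\<exists>n\<ge>N. \<exists>K A. finite K \<and> (LINT x|lborel. (cmod (indicator {0..1} x
           - (\<Sum>k\<in>K. \<Sum>i\<in>UNIV. A k $ i * two_sided \<phi> (real d ^ n * x - of_int k) $ i)))\<^sup>2) \<le> \<epsilon>"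
      using MRA_fine_approximation[OF mra _ L2 eps, of N] d
      unfolding level_combination_stacked by fastforce
  qed
  moreover have "continuous_moment (two_sided \<phi>) 0 $ i = (LINT x|lborel. two_sided \<phi> x $ i)" for i
    using moment_nth[of 0 "two_sided \<phi>" i] integrable_continuous_bounded_support[OF cont' R'] by simp
  moreover have "conj_dot v v = of_real (\<Sum>i\<in>UNIV. (cmod (v $ i))\<^sup>2)" for v :: "complex^('r + 'r)"
    unfolding conj_dot_def of_real_sum complex_norm_square by (simp add: mult.commute)
  ultimately show ?thesis by (simp del: of_real_sum)
qed

section \<open>The recursive computation of the moments\<close>

lemma matrix_inv_mult_vector:
  fixes A :: "complex^'n^'n"
  assumes "invertible A"
  shows "matrix_inv A *v (A *v x) = x"
proof -
  have "matrix_inv A ** A = mat 1"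
    using assms unfolding invertible_def matrix_inv_def by (rule someI2_ex) simp
  then show ?thesis by (simp add: matrix_vector_mul_assoc)
qed

lemma two_sided_moment_refinement:
  fixes \<phi> f :: "real \<Rightarrow> complex^'r"
  assumes "d > 0" "real_finite_coeffs Cp" "real_finite_coeffs Cm"
    and f: "\<And>x. f x = two_direction_sum d Cp Cm \<phi> x"
    and int: "\<And>j. integrable lborel (\<lambda>x. (x ^ j) *\<^sub>R two_sided \<phi> x)"
  shows "integrable lborel (\<lambda>x. (x ^ j) *\<^sub>R two_sided f x)"
    and "continuous_moment (two_sided f) j = (1 / real d ^ j) *\<^sub>R
      (\<Sum>l=0..j. real (j choose l) *\<^sub>R
        (discrete_moment d Cp Cm (j - l) *v continuous_moment (two_sided \<phi>) l))"
proof -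
  obtain K where K: "finite K" "\<And>k. k \<notin> K \<Longrightarrow> Cp k = 0 \<and> Cm k = 0" "\<And>k. - k \<in> K \<longleftrightarrow> k \<in> K"
    using obtain_symmetric_support assms(2,3) by metis
  have d: "real d > 0" using assms(1) by simp
  have f': "two_sided f x = sqrt (real d) *\<^sub>R
      (\<Sum>k\<in>K. stacked_coeff Cp Cm k *v two_sided \<phi> (real d * x - of_int k))" for x
    using K f by (rule two_sided_refinement)
  have moment: "discrete_moment d Cp Cm i =
      (1 / sqrt (real d)) *\<^sub>R (\<Sum>k\<in>K. (real_of_int k ^ i) *\<^sub>R stacked_coeff Cp Cm k)" for i
    using K by (rule discrete_moment_finite_sum)
  note ref = continuous_moment_refinement[OF int d f']
  show "integrable lborel (\<lambda>x. (x ^ j) *\<^sub>R two_sided f x)"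
    by (rule ref(1))
  show "continuous_moment (two_sided f) j = (1 / real d ^ j) *\<^sub>R
      (\<Sum>l=0..j. real (j choose l) *\<^sub>R
        (discrete_moment d Cp Cm (j - l) *v continuous_moment (two_sided \<phi>) l))"
    unfolding moment by (rule ref(2))
qed

theorem theorem3p5:
  fixes d :: nat
    and Pp Pm :: "int \<Rightarrow> complex^'r^'r"
    and Qp Qm :: "nat \<Rightarrow> int \<Rightarrow> complex^'r^'r"
    and \<phi> :: "real \<Rightarrow> complex^'r"
    and \<psi> :: "nat \<Rightarrow> real \<Rightarrow> complex^'r"
  assumes "d \<ge> 2"
    and "two_direction_multiscaling d Pp Pm \<phi>"
    and "two_direction_multiwavelets d \<phi> Qp Qm \<psi>"
    and "two_direction_orthogonal \<phi>"
    and "has_compact_support \<phi>"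
    and "continuous_on UNIV \<phi>"
    and "condition_E d Pp Pm"
  shows
    "let M = discrete_moment d Pp Pm;
         N = (\<lambda>s. discrete_moment d (Qp s) (Qm s));
         m = continuous_moment (two_sided \<phi>);
         n = (\<lambda>s. continuous_moment (two_sided (\<psi> s)))
     in
       m 0 = M 0 *v m 0 \<and>
       conj_dot (m 0) (m 0) = 1 \<and>
       (\<forall>j\<ge>1.
          invertible ((real d ^ j) *\<^sub>R mat 1 - M 0) \<and>
          m j = matrix_inv ((real d ^ j) *\<^sub>R mat 1 - M 0) *v
                  (\<Sum>l = 0..j - 1. real (j choose l) *\<^sub>R (M (j - l) *v m l))) \<and>
       (\<forall>j. \<forall>s\<in>{1..d - 1}.
          n s j = (1 / real d ^ j) *\<^sub>R
                  (\<Sum>l = 0..j. real (j choose l) *\<^sub>R (N s (j - l) *v m l))) \<and>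
       (\<forall>\<mu> \<nu>.
          \<mu> 0 = m 0 \<and>
          (\<forall>j\<ge>1. \<mu> j = matrix_inv ((real d ^ j) *\<^sub>R mat 1 - M 0) *v
                  (\<Sum>l = 0..j - 1. real (j choose l) *\<^sub>R (M (j - l) *v \<mu> l))) \<and>
          (\<forall>j. \<forall>s\<in>{1..d - 1}.
             \<nu> s j = (1 / real d ^ j) *\<^sub>R
                  (\<Sum>l = 0..j. real (j choose l) *\<^sub>R (N s (j - l) *v \<mu> l)))
          \<longrightarrow> (\<forall>j. \<mu> j = m j) \<and> (\<forall>j. \<forall>s\<in>{1..d - 1}. \<nu> s j = n s j)) \<and>
       (\<forall>j. continuous_moment \<phi> j = upper_half (m j) \<and>
            (\<forall>s\<in>{1..d - 1}. continuous_moment (\<psi> s) j = upper_half (n s j)))"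
proof -
  define M where "M = discrete_moment d Pp Pm"
  define N where "N = (\<lambda>s. discrete_moment d (Qp s) (Qm s))"
  define m where "m = continuous_moment (two_sided \<phi>)"
  define n where "n = (\<lambda>s. continuous_moment (two_sided (\<psi> s)))"
  have d: "d > 0" "real d > 1" using assms(1) by auto
  have P: "real_finite_coeffs Pp" "real_finite_coeffs Pm" and \<phi>: "\<And>x. \<phi> x = two_direction_sum d Pp Pm \<phi> x"
    and mra: "generates_MRA d \<phi>"
    using assms(2) by (simp_all add: two_direction_multiscaling_def)
  have Q: "real_finite_coeffs (Qp s)" "real_finite_coeffs (Qm s)"
    and \<psi>: "\<psi> s x = two_direction_sum d (Qp s) (Qm s) \<phi> x" if "s \<in> {1..d - 1}" for s x
    using assms(3) that by (simp_all add: two_direction_multiwavelets_def)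
  have int: "integrable lborel (\<lambda>x. (x ^ j) *\<^sub>R two_sided \<phi> x)" for j
  proof -
    obtain R :: nat where R: "\<And>x. \<bar>x\<bar> > real R \<Longrightarrow> \<phi> x = 0"
      using compact_support_bound[OF assms(5)] by blast
    show ?thesis
    proof (rule integrable_continuous_bounded_support[of _ "real R"])
      show "continuous_on UNIV (\<lambda>x. (x ^ j) *\<^sub>R two_sided \<phi> x)"
        by (intro continuous_intros continuous_on_two_sided assms(6))
      show "(x ^ j) *\<^sub>R two_sided \<phi> x = 0" if "\<bar>x\<bar> > real R" for x
        using that by (simp add: vec_eq_iff split_sum_all R)
    qed
  qed
  have m_rec: "m j = (1 / real d ^ j) *\<^sub>R (\<Sum>l=0..j. real (j choose l) *\<^sub>R (M (j - l) *v m l))" for j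
    unfolding m_def M_def using two_sided_moment_refinement(2)[OF d(1) P \<phi> int] .
  have n_rec: "n s j = (1 / real d ^ j) *\<^sub>R (\<Sum>l=0..j. real (j choose l) *\<^sub>R (N s (j - l) *v m l))"
    if "s \<in> {1..d - 1}" for s j
    unfolding m_def n_def N_def using two_sided_moment_refinement(2)[OF d(1) Q[OF that] \<psi>[OF that] int] .
  have fixpoint: "m 0 = M 0 *v m 0"
    using m_rec[of 0] by simp
  have normal: "conj_dot (m 0) (m 0) = 1"
    unfolding m_def using moment_zero_normalized[OF assms(1) mra assms(4-6)] .
  have inv: "invertible ((real d ^ j) *\<^sub>R mat 1 - M 0)" if "j \<ge> 1" for j
  proof (rule invertible_above_spectral_radius)
    show "cmod z \<le> 1" if "is_eigenvalue (M 0) z" for z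
      using condition_E_eigenvalue_bound[OF assms(7) P] that unfolding M_def .
    show "real d ^ j > 1"
      using d(2) that by (intro one_less_power) auto
  qed
  have m_step: "m j = matrix_inv ((real d ^ j) *\<^sub>R mat 1 - M 0) *v
      (\<Sum>l = 0..j - 1. real (j choose l) *\<^sub>R (M (j - l) *v m l))" (is "_ = _ *v ?S")
    if j: "j \<ge> 1" for j
  proof -
    \<comment> \<open>The term \<open>l = j\<close> of the moment relation contains \<open>m j\<close> itself and moves to the left-hand side.\<close>
    have "{0..j} = insert j {0..j - 1}" using j by auto
    then have "(\<Sum>l=0..j. real (j choose l) *\<^sub>R (M (j - l) *v m l)) = M 0 *v m j + ?S"
      using j by (simp add: sum.insert_if)
    moreover have "(real d ^ j) *\<^sub>R m j = (real d ^ j) *\<^sub>R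
        ((1 / real d ^ j) *\<^sub>R (\<Sum>l=0..j. real (j choose l) *\<^sub>R (M (j - l) *v m l)))"
      using m_rec[of j] by (rule arg_cong)
    ultimately have "(real d ^ j) *\<^sub>R m j = M 0 *v m j + ?S"
      using d by simp
    then have "((real d ^ j) *\<^sub>R mat 1 - M 0) *v m j = ?S"
      by (simp add: matrix_vector_mult_diff_rdistrib matrix_vector_scaleR_left)
    then show ?thesis
      using matrix_inv_mult_vector[OF inv[OF j], of "m j"] by simp
  qed
  have unique: "(\<forall>j. \<mu> j = m j) \<and> (\<forall>j. \<forall>s\<in>{1..d - 1}. \<nu> s j = n s j)"
    if \<mu>0: "\<mu> 0 = m 0"
      and \<mu>: "\<forall>j\<ge>1. \<mu> j = matrix_inv ((real d ^ j) *\<^sub>R mat 1 - M 0) *v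
          (\<Sum>l = 0..j - 1. real (j choose l) *\<^sub>R (M (j - l) *v \<mu> l))"
      and \<nu>: "\<forall>j. \<forall>s\<in>{1..d - 1}. \<nu> s j = (1 / real d ^ j) *\<^sub>R
          (\<Sum>l = 0..j. real (j choose l) *\<^sub>R (N s (j - l) *v \<mu> l))" for \<mu> \<nu>
  proof -
    have eq: "\<mu> j = m j" for j
    proof (induction j rule: less_induct)
      case (less j)
      show ?case
      proof (cases "j = 0")
        case False
        then have j: "j \<ge> 1" by simp
        then have lower: "(\<Sum>l = 0..j - 1. real (j choose l) *\<^sub>R (M (j - l) *v \<mu> l)) =
            (\<Sum>l = 0..j - 1. real (j choose l) *\<^sub>R (M (j - l) *v m l))"
          by (intro sum.cong refl) (simp add: less.IH)
        show ?thesis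
          unfolding \<mu>[rule_format, OF j] lower m_step[OF j, symmetric] ..
      qed (simp add: \<mu>0)
    qed
    then show ?thesis using \<nu> n_rec by simp
  qed
  have halves: "continuous_moment \<phi> j = upper_half (m j)"
    "s \<in> {1..d - 1} \<Longrightarrow> continuous_moment (\<psi> s) j = upper_half (n s j)" for j s
    unfolding m_def n_def
    by (rule continuous_moment_upper_half[OF int])
       (rule continuous_moment_upper_half[OF two_sided_moment_refinement(1)[OF d(1) Q \<psi> int]])
  show ?thesis
    unfolding Let_def M_def[symmetric] N_def[symmetric] m_def[symmetric] n_def[symmetric]
  proof (intro conjI, goal_cases)
    case 1
    show ?case by (rule fixpoint)
  next
    case 2
    show ?case by (rule normal)
  next
    case 3
    show ?case by (intro allI impI conjI; (rule inv | rule m_step); assumption)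
  next
    case 4
    show ?case by (intro allI ballI; rule n_rec; assumption)
  next
    case 5
    show ?case by (intro allI impI; elim conjE; rule unique; assumption)
  next
    case 6
    show ?case by (intro allI conjI ballI; (rule halves(1) | rule halves(2), assumption))
  qed
qed

end
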